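(* Let $S$ be a non-empty subset of $\mathbb{Z}_{\ge2}$ and consider $\mathcal{L}\mathcal{R}$-Subtraction Nim with removable set $S$. Then for all $n\in\mathbb{Z}_{\ge0}$ (where statements about $n-1$ are only asserted when $n\ge1$): \begin{enumerate} \item[(1)] If $\mathcal{O}_S(n)=\mathcal{R}$, then $\mathcal{O}_S(n-1)=\mathcal{O}_S(n+1)=\mathcal{L}$. \item[(2)] If $\mathcal{O}_S(n)=\mathcal{P}$, then $\mathcal{O}_S(n-1),\mathcal{O}_S(n+1)\in\{\mathcal{L},\mathcal{P}\}$. \item[(3)] If $\mathcal{O}_S(n)=\mathcal{N}$, then $\mathcal{O}_S(n-1),\mathcal{O}_S(n+1)\in\{\mathcal{L},\mathcal{N}\}$. \item[(4)] Every maximal run of consecutive $\mathcal{P}$-positions in the sequence $(\mathcal{O}_S(n))_{n\ge0}$ has length at most $\min(S)-1$, and the positions immediately before and immediately after the run are $\mathcal{L}$-positions. \item[(5)] For every maximal run of consecutive $\mathcal{N}$-positions in the sequence $(\mathcal{O}_S(n))_{n\ge0}$, the position immediately before the run is an $\mathcal{L}$-position; if the run is finite, the position immediately after it is an $\mathcal{L}$-position. In particular, if $S$ is finite, every maximal run of consecutive $\mathcal{N}$-positions has length at most $\max(S)-1$ and is flanked on both sides by $\mathcal{L}$-positions. \end{enumerate}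
   Context: $\mathcal{L}\mathcal{R}$-Subtraction Nim with removable set $S$ (a non-empty subset of $\mathbb{Z}_{\ge 2}$, possibly infinite): a position is a number $n\in\mathbb{Z}_{\ge0}$ of tokens. Players Left and Right alternate moves; a move from $n$ removes $s$ tokens for some $s\in S$ with $s\le n$, leading to $n-s$. When the player to move has no move (i.e. $n<\min S$), the game ends; Left wins if the number $n$ of remaining tokens is even and Right wins if $n$ is odd (regardless of who is to move). The outcome $\mathcal{O}_S(n)$ is $\mathcal{L}$ if Left has a winning strategy from $n$ both moving first and moving second; $\mathcal{R}$ if Right has a winning strategy both moving first and moving second; $\mathcal{N}$ if the first player to move (whether Left or Right) has a winning strategy; $\mathcal{P}$ if the second player (whether Left or Right) has a winning strategy. *)

theory Defs
  imports Main
begin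

datatype player = Left | Right

fun opponent :: "player \<Rightarrow> player" where
  "opponent Left = Right"
| "opponent Right = Left"

definition is_move :: "nat set \<Rightarrow> nat \<Rightarrow> nat \<Rightarrow> bool" where
  "is_move S n m \<longleftrightarrow> (\<exists>s\<in>S. s \<le> n \<and> m = n - s)"

definition terminal :: "nat set \<Rightarrow> nat \<Rightarrow> bool" where
  "terminal S n \<longleftrightarrow> (\<nexists>m. is_move S n m)"

fun wins_terminal :: "player \<Rightarrow> nat \<Rightarrow> bool" where
  "wins_terminal Left n \<longleftrightarrow> even n"
| "wins_terminal Right n \<longleftrightarrow> odd n"

text \<open>The list of successive positions of a game played to its end.\<close>

definition complete_play :: "nat set \<Rightarrow> nat \<Rightarrow> nat list \<Rightarrow> bool" where
  "complete_play S n xs \<longleftrightarrow> xs \<noteq> [] \<and> hd xs = n \<and>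
     (\<forall>i. Suc i < length xs \<longrightarrow> is_move S (xs ! i) (xs ! Suc i)) \<and> terminal S (last xs)"

text \<open>The player to move after \<open>i\<close> moves, if player \<open>p\<close> moved first.\<close>

definition mover :: "player \<Rightarrow> nat \<Rightarrow> player" where
  "mover p i = (if even i then p else opponent p)"

text \<open>A strategy maps the list of positions visited so far (oldest first, the current position
  last) to the next position; it may depend on the whole history.\<close>

type_synonym strategy = "nat list \<Rightarrow> nat"

definition legal_strategy :: "nat set \<Rightarrow> strategy \<Rightarrow> bool" where
  "legal_strategy S \<sigma> \<longleftrightarrow>
     (\<forall>h. h \<noteq> [] \<and> \<not> terminal S (last h) \<longrightarrow> is_move S (last h) (\<sigma> h))"

text \<open>Player \<open>w\<close> uses \<open>\<sigma>\<close> throughout the play \<open>xs\<close>, in which player \<open>p\<close> moved first.\<close>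

definition follows :: "strategy \<Rightarrow> player \<Rightarrow> player \<Rightarrow> nat list \<Rightarrow> bool" where
  "follows \<sigma> w p xs \<longleftrightarrow>
     (\<forall>i. Suc i < length xs \<and> mover p i = w \<longrightarrow> xs ! Suc i = \<sigma> (take (Suc i) xs))"

text \<open>Player \<open>w\<close> has a winning strategy from \<open>n\<close> when player \<open>p\<close> moves first.\<close>

definition has_winning_strategy :: "nat set \<Rightarrow> player \<Rightarrow> player \<Rightarrow> nat \<Rightarrow> bool" where
  "has_winning_strategy S w p n \<longleftrightarrow>
     (\<exists>\<sigma>. legal_strategy S \<sigma> \<and>
        (\<forall>xs. complete_play S n xs \<and> follows \<sigma> w p xs \<longrightarrow> wins_terminal w (last xs)))"

datatype outcome = Out_L | Out_R | Out_N | Out_P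

fun has_outcome :: "nat set \<Rightarrow> nat \<Rightarrow> outcome \<Rightarrow> bool" where
  "has_outcome S n Out_L \<longleftrightarrow> (\<forall>p. has_winning_strategy S Left p n)"
| "has_outcome S n Out_R \<longleftrightarrow> (\<forall>p. has_winning_strategy S Right p n)"
| "has_outcome S n Out_N \<longleftrightarrow> (\<forall>p. has_winning_strategy S p p n)"
| "has_outcome S n Out_P \<longleftrightarrow> (\<forall>p. has_winning_strategy S (opponent p) p n)"

text \<open>Exactly one outcome applies to each position when \<open>0 \<notin> S\<close>, since all plays are then
  finite and never drawn.\<close>

definition outcome :: "nat set \<Rightarrow> nat \<Rightarrow> outcome" where
  "outcome S n = (THE X. has_outcome S n X)"

text \<open>Runs are non-empty, possibly infinite, sets of consecutive indices.\<close>

definition is_run :: "(nat \<Rightarrow> 'a) \<Rightarrow> 'a \<Rightarrow> nat set \<Rightarrow> bool" where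
  "is_run f x I \<longleftrightarrow> I \<noteq> {} \<and> (\<forall>a\<in>I. \<forall>b\<in>I. {a..b} \<subseteq> I) \<and> (\<forall>n\<in>I. f n = x)"

definition maximal_run :: "(nat \<Rightarrow> 'a) \<Rightarrow> 'a \<Rightarrow> nat set \<Rightarrow> bool" where
  "maximal_run f x I \<longleftrightarrow> is_run f x I \<and> (\<forall>J. is_run f x J \<and> I \<subseteq> J \<longrightarrow> J = I)"

end

theory Submission
  imports Defs
begin

text \<open>Write \<open>A n\<close> and \<open>B n\<close> for ``Left wins from \<open>n\<close>'' when Left, respectively Right, moves first.
  The neighbour claims (1)--(3) together say exactly that \<open>A n \<or> B (n + 1)\<close> and
  \<open>B n \<or> A (n + 1)\<close> for all \<open>n\<close>, and this follows by induction: a move \<open>s\<close> available at \<open>n\<close> is also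
  available at \<open>n + 1\<close>, and the only additional move leads to \<open>0\<close>, where Left wins.
  If \<open>n\<close> and \<open>n + min S - 1\<close> were both \<open>\<P>\<close>, then removing \<open>min S\<close> from the latter would make
  \<open>n - 1\<close> an \<open>\<N>\<close>-position next to a \<open>\<P>\<close>-position.  If \<open>n, \<dots>, n + max S - 1\<close> were all \<open>\<N>\<close>, every
  move from the last one would lead to a position where Left wins moving first.\<close>

section \<open>Determinacy\<close>

lemma opponent_opponent [simp]: "opponent (opponent p) = p"
  by (cases p) auto

lemma opponent_neq [simp]: "opponent p \<noteq> p" "p \<noteq> opponent p"
  by (cases p; simp)+

lemma all_player_iff: "(\<forall>p. Q p) \<longleftrightarrow> Q Left \<and> Q Right"
  by (metis player.exhaust)

lemma mover_0 [simp]: "mover p 0 = p"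
  by (simp add: mover_def)

lemma mover_Suc [simp]: "mover p (Suc i) = opponent (mover p i)"
  by (simp add: mover_def)

lemma is_move_less:
  assumes "0 \<notin> S" "is_move S n m"
  shows "m < n"
  using assms unfolding is_move_def
  by (metis diff_less le_zero_eq not_gr_zero zero_less_iff_neq_zero order.strict_trans2)

lemma wins_terminal_opponent: "wins_terminal (opponent w) n \<longleftrightarrow> \<not> wins_terminal w n"
  by (cases w) auto

text \<open>Lets the termination goal for the recursive call under the existential quantifier assume
  the conjunct \<open>m < n\<close>.\<close>

declare conj_cong [fundef_cong]

text \<open>The bound \<open>m < n\<close> only serves termination; it holds for all moves when \<open>0 \<notin> S\<close>.\<close>

function wins :: "nat set \<Rightarrow> player \<Rightarrow> player \<Rightarrow> nat \<Rightarrow> bool" where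
  "wins S w p n \<longleftrightarrow>
     (if terminal S n then wins_terminal w n
      else if p = w then \<exists>m. m < n \<and> is_move S n m \<and> wins S w (opponent p) m
      else \<forall>m. m < n \<longrightarrow> is_move S n m \<longrightarrow> wins S w (opponent p) m)"
  by pat_completeness auto
termination
  by (relation "measure (\<lambda>(S, w, p, n). n)") auto

declare conj_cong [fundef_cong del] wins.simps [simp del]

lemma wins_terminal_iff: "terminal S n \<Longrightarrow> wins S w p n \<longleftrightarrow> wins_terminal w n"
  by (simp add: wins.simps)

lemma wins_own_move_iff:
  assumes "0 \<notin> S" "\<not> terminal S n"
  shows "wins S w w n \<longleftrightarrow> (\<exists>m. is_move S n m \<and> wins S w (opponent w) m)"
  using assms is_move_less[of S n] by (subst wins.simps) auto

lemma wins_other_move_iff: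
  assumes "0 \<notin> S" "\<not> terminal S n" "p \<noteq> w"
  shows "wins S w p n \<longleftrightarrow> (\<forall>m. is_move S n m \<longrightarrow> wins S w (opponent p) m)"
  using assms is_move_less[of S n] by (subst wins.simps) auto

text \<open>Determinacy: exchanging the players turns the existential clause into the universal one
  and negates the terminal condition, so the two sides are De Morgan duals.\<close>

lemma wins_opponent_iff:
  assumes "0 \<notin> S"
  shows "wins S (opponent w) p n \<longleftrightarrow> \<not> wins S w p n"
proof (induction n arbitrary: p rule: less_induct)
  case (less n)
  have IH: "wins S (opponent w) q m \<longleftrightarrow> \<not> wins S w q m" if "is_move S n m" for q m
    using less is_move_less[OF assms that] by blast
  show ?case
  proof (cases "terminal S n")
    case True
    then show ?thesis by (simp add: wins_terminal_iff wins_terminal_opponent)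
  next
    case nt: False
    show ?thesis
    proof (cases "p = w")
      case True
      then show ?thesis
        using IH wins_own_move_iff[OF assms nt, of w]
          wins_other_move_iff[OF assms nt, of w "opponent w"] by auto
    next
      case False
      then have "p = opponent w" by (cases p; cases w) auto
      then show ?thesis
        using IH wins_own_move_iff[OF assms nt, of "opponent w"]
          wins_other_move_iff[OF assms nt, of "opponent w" w] by auto
    qed
  qed
qed

text \<open>Looks only at the current position. The fallback branch keeps the strategy legal where
  no winning move exists.\<close>

definition winning_move :: "nat set \<Rightarrow> player \<Rightarrow> strategy" where
  "winning_move S w h =
     (if \<exists>m. is_move S (last h) m \<and> wins S w (opponent w) m
      then SOME m. is_move S (last h) m \<and> wins S w (opponent w) m
      else SOME m. is_move S (last h) m)"

lemma winning_move_wins: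
  assumes "\<exists>m. is_move S (last h) m \<and> wins S w (opponent w) m"
  shows "is_move S (last h) (winning_move S w h)" "wins S w (opponent w) (winning_move S w h)"
  using someI_ex[OF assms] assms unfolding winning_move_def by auto

lemma legal_winning_move: "legal_strategy S (winning_move S w)"
  unfolding legal_strategy_def
proof (intro allI impI, elim conjE)
  fix h assume "\<not> terminal S (last h)"
  then have ex: "\<exists>m. is_move S (last h) m" by (simp add: terminal_def)
  show "is_move S (last h) (winning_move S w h)"
  proof (cases "\<exists>m. is_move S (last h) m \<and> wins S w (opponent w) m")
    case True
    then show ?thesis by (rule winning_move_wins)
  next
    case False
    then show ?thesis using someI_ex[OF ex] by (auto simp: winning_move_def)
  qed
qed

section \<open>Equivalence of the recursion with strategies on whole plays\<close>

lemma wins_imp_has_winning_strategy: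
  assumes S: "0 \<notin> S" and win: "wins S w p n"
  shows "has_winning_strategy S w p n"
  unfolding has_winning_strategy_def
proof (intro exI[of _ "winning_move S w"] conjI allI impI legal_winning_move, elim conjE)
  fix xs assume cp: "complete_play S n xs" and fo: "follows (winning_move S w) w p xs"
  from cp have ne: "xs \<noteq> []" and hd: "hd xs = n" and fin: "terminal S (last xs)"
    and mv: "\<And>i. Suc i < length xs \<Longrightarrow> is_move S (xs ! i) (xs ! Suc i)"
    by (auto simp: complete_play_def)
  \<comment> \<open>Chosen moves of \<open>w\<close> and arbitrary moves of the opponent both
    preserve the winning status; at the end of the play it becomes
    \<open>wins_terminal\<close>.\<close>
  have inv: "i < length xs \<Longrightarrow> wins S w (mover p i) (xs ! i)" for i
  proof (induction i)
    case 0
    then show ?case using win hd ne by (simp add: hd_conv_nth)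
  next
    case (Suc i)
    then have IH: "wins S w (mover p i) (xs ! i)" by simp
    have m: "is_move S (xs ! i) (xs ! Suc i)" using mv Suc by simp
    then have nt: "\<not> terminal S (xs ! i)" by (auto simp: terminal_def)
    show ?case
    proof (cases "mover p i = w")
      case True
      have "last (take (Suc i) xs) = xs ! i"
        using Suc by (simp add: take_Suc_conv_app_nth)
      then have "wins S w (opponent w) (winning_move S w (take (Suc i) xs))"
        using winning_move_wins(2) IH True wins_own_move_iff[OF S nt] by simp
      then show ?thesis using fo Suc True by (simp add: follows_def)
    next
      case False
      then show ?thesis using IH m wins_other_move_iff[OF S nt] by simp
    qed
  qed
  show "wins_terminal w (last xs)"
    using inv[of "length xs - 1"] ne fin by (simp add: wins_terminal_iff last_conv_nth)
qed

text \<open>Refutes an arbitrary, possibly history-dependent strategy from a lost position. Starting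
  from a partial play \<open>h\<close>, in which \<open>length h - 1\<close> moves have been made,
  lets the induction follow the decreasing current position.\<close>

lemma extend_losing_play:
  assumes S: "0 \<notin> S" and \<sigma>: "legal_strategy S \<sigma>"
    and "h \<noteq> []" "\<forall>i. Suc i < length h \<longrightarrow> is_move S (h ! i) (h ! Suc i)"
    and "follows \<sigma> w p h" and "\<not> wins S w (mover p (length h - 1)) (last h)"
  shows "\<exists>xs. complete_play S (hd h) xs \<and> follows \<sigma> w p xs \<and> \<not> wins_terminal w (last xs)"
  using assms(3-)
proof (induction "last h" arbitrary: h rule: less_induct)
  case less
  show ?case
  proof (cases "terminal S (last h)")
    case True
    then show ?thesis
      using less.prems by (intro exI[of _ h]) (auto simp: complete_play_def wins_terminal_iff)
  next
    case nt: False
    let ?q = "mover p (length h - 1)"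
    \<comment> \<open>If \<open>w\<close> is to move, every move loses, including the one prescribed
      by \<open>\<sigma>\<close>; otherwise the opponent has a refuting move.\<close>
    have "\<exists>m. is_move S (last h) m \<and> \<not> wins S w (opponent ?q) m \<and> (?q = w \<longrightarrow> m = \<sigma> h)"
    proof (cases "?q = w")
      case True
      have "is_move S (last h) (\<sigma> h)"
        using \<sigma> nt less.prems(1) by (auto simp: legal_strategy_def)
      then show ?thesis using less.prems(4) wins_own_move_iff[OF S nt] True by auto
    next
      case False
      then show ?thesis using less.prems(4) wins_other_move_iff[OF S nt] by auto
    qed
    then obtain m where m: "is_move S (last h) m" "\<not> wins S w (opponent ?q) m"
      "?q = w \<Longrightarrow> m = \<sigma> h" by blast
    let ?h = "h @ [m]"
    have last: "last h = h ! (length h - 1)" using less.prems(1) by (simp add: last_conv_nth)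
    have pos: "Suc i < length ?h \<Longrightarrow> Suc i < length h \<or> Suc i = length h" for i by auto
    have "mover p (length h) = opponent ?q"
      using less.prems(1) mover_Suc[of p "length h - 1"] by simp
    moreover have "\<forall>i. Suc i < length ?h \<longrightarrow> is_move S (?h ! i) (?h ! Suc i)"
    proof (intro allI impI)
      fix i assume "Suc i < length ?h"
      then consider "Suc i < length h" | "Suc i = length h" using pos by blast
      then show "is_move S (?h ! i) (?h ! Suc i)"
      proof cases
        case 1
        then show ?thesis using less.prems(2) by (simp add: nth_append)
      next
        case 2
        then have "i = length h - 1" by simp
        then show ?thesis using m(1) last 2 less.prems(1) by (simp add: nth_append)
      qed
    qed
    moreover have "follows \<sigma> w p ?h"
      unfolding follows_def
    proof (intro allI impI, elim conjE)
      fix i assume "Suc i < length ?h" and w: "mover p i = w"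
      then consider "Suc i < length h" | "Suc i = length h" using pos by blast
      then show "?h ! Suc i = \<sigma> (take (Suc i) ?h)"
      proof cases
        case 1
        then show ?thesis using less.prems(3) w by (simp add: nth_append follows_def)
      next
        case 2
        then have "?q = w" using w by (metis diff_Suc_1)
        then show ?thesis using m(3) 2 by (simp add: nth_append)
      qed
    qed
    ultimately have "\<exists>xs. complete_play S (hd ?h) xs \<and> follows \<sigma> w p xs \<and> \<not> wins_terminal w (last xs)"
      using less.hyps[of ?h] is_move_less[OF S m(1)] m(2) by simp
    then show ?thesis using less.prems(1) by simp
  qed
qed

theorem has_winning_strategy_iff_wins:
  assumes "0 \<notin> S"
  shows "has_winning_strategy S w p n \<longleftrightarrow> wins S w p n"
proof
  show "wins S w p n" if "has_winning_strategy S w p n"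
  proof (rule ccontr)
    assume "\<not> wins S w p n"
    moreover from that obtain \<sigma> where "legal_strategy S \<sigma>"
      "\<forall>xs. complete_play S n xs \<and> follows \<sigma> w p xs \<longrightarrow> wins_terminal w (last xs)"
      by (auto simp: has_winning_strategy_def)
    ultimately show False
      \<comment> \<open>The play \<open>[n]\<close> contains no move yet, so it follows any
        strategy.\<close>
      using extend_losing_play[OF assms, of \<sigma> "[n]" w p] by (auto simp: follows_def)
  qed
qed (rule wins_imp_has_winning_strategy[OF assms])

text \<open>By determinacy Right's wins are the negations of Left's. The four outcomes thus match
  the four pairs of truth values for Left, and the definite description is well defined.\<close>

lemma outcome_eq:
  assumes "0 \<notin> S"
  shows "outcome S n =
    (if wins S Left Left n then if wins S Left Right n then Out_L else Out_N
     else if wins S Left Right n then Out_P else Out_R)"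
proof -
  have R: "wins S Right p n \<longleftrightarrow> \<not> wins S Left p n" for p
    using wins_opponent_iff[OF assms, of Left] by simp
  have H: "has_outcome S n X \<longleftrightarrow> X =
    (if wins S Left Left n then if wins S Left Right n then Out_L else Out_N
     else if wins S Left Right n then Out_P else Out_R)" for X
    by (cases X) (simp_all add: all_player_iff has_winning_strategy_iff_wins[OF assms] R)
  show ?thesis unfolding outcome_def by (rule the_equality) (simp_all only: H)
qed

section \<open>Neighbouring positions\<close>

lemma outcome_cases_iff:
  assumes "0 \<notin> S"
  shows "outcome S n = Out_L \<longleftrightarrow> wins S Left Left n \<and> wins S Left Right n"
    "outcome S n = Out_R \<longleftrightarrow> \<not> wins S Left Left n \<and> \<not> wins S Left Right n"
    "outcome S n = Out_N \<longleftrightarrow> wins S Left Left n \<and> \<not> wins S Left Right n"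
    "outcome S n = Out_P \<longleftrightarrow> \<not> wins S Left Left n \<and> wins S Left Right n"
  by (simp_all add: outcome_eq[OF assms])

section \<open>The recursion for Left in terms of removals\<close>

lemma terminal_iff: "terminal S n \<longleftrightarrow> (\<forall>s\<in>S. n < s)"
  by (auto simp: terminal_def is_move_def not_le[symmetric])

lemma Left_first_wins_iff:
  assumes "0 \<notin> S" "\<not> terminal S n"
  shows "wins S Left Left n \<longleftrightarrow> (\<exists>s\<in>S. s \<le> n \<and> wins S Left Right (n - s))"
  using wins_own_move_iff[OF assms, of Left] by (auto simp: is_move_def)

lemma Right_first_wins_iff:
  assumes "0 \<notin> S" "\<not> terminal S n"
  shows "wins S Left Right n \<longleftrightarrow> (\<forall>s\<in>S. s \<le> n \<longrightarrow> wins S Left Left (n - s))"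
  using wins_other_move_iff[OF assms, of Right Left] by (auto simp: is_move_def)

lemma Left_wins_0: "0 \<notin> S \<Longrightarrow> wins S Left p 0"
  by (subst wins_terminal_iff) (auto simp: terminal_iff intro: gr0I)

lemma Left_wins_adjacent:
  assumes S: "0 \<notin> S"
  shows "(wins S Left Left n \<or> wins S Left Right (Suc n)) \<and>
    (wins S Left Right n \<or> wins S Left Left (Suc n))"
proof (induction n rule: less_induct)
  case (less n)
  have IH: "wins S Left Left (n - s) \<or> wins S Left Right (Suc n - s)"
    "wins S Left Right (n - s) \<or> wins S Left Left (Suc n - s)" if "s \<in> S" "s \<le> n" for s
    using less[of "n - s"] that S by (metis Suc_diff_le diff_less gr0I le_zero_eq order.strict_trans2)+
  show ?case
  proof (cases "terminal S (Suc n)")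
    case True
    then have "terminal S n" by (auto simp: terminal_iff)
    \<comment> \<open>Of two consecutive terminal positions one is even, and Left wins there whoever
      moves first.\<close>
    with True show ?thesis by (auto simp: wins_terminal_iff)
  next
    case nt': False
    note Suc_iff = Left_first_wins_iff[OF S nt'] Right_first_wins_iff[OF S nt']
    show ?thesis
    proof (cases "terminal S n")
      case True
      \<comment> \<open>The only move from \<open>Suc n\<close> removes everything and reaches 0,
        where Left wins.\<close>
      then have "s = Suc n" if "s \<in> S" "s \<le> Suc n" for s
        using that by (auto simp: terminal_iff)
      moreover from this have "Suc n \<in> S" using nt' by (auto simp: terminal_iff not_less)
      ultimately show ?thesis
        using Left_wins_0[OF S] unfolding Suc_iff by (metis diff_self_eq_0 order_refl)
    next
      case nt: False
      have "wins S Left Right (Suc n)" if "\<not> wins S Left Left n"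
        unfolding Suc_iff
      proof (intro ballI impI)
        fix s assume s: "s \<in> S" "s \<le> Suc n"
        show "wins S Left Left (Suc n - s)"
        proof (cases "s \<le> n")
          case True
          \<comment> \<open>Left loses moving first at \<open>n\<close>, so removing
            \<open>s\<close> leads to a loss with Right to move at \<open>n - s\<close>; the
            induction hypothesis turns this into a win moving first one token higher.\<close>
          then show ?thesis using IH(2) s(1) that Left_first_wins_iff[OF S nt] by blast
        next
          case False
          then show ?thesis using s(2) Left_wins_0[OF S] by simp
        qed
      qed
      \<comment> \<open>Left copies the removal with which Right wins from \<open>n\<close>.\<close>
      moreover have "wins S Left Left (Suc n)" if "\<not> wins S Left Right n"
        unfolding Suc_iff using that IH(1) le_SucI unfolding Right_first_wins_iff[OF S nt] by blast
      ultimately show ?thesis by blast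
    qed
  qed
qed

text \<open>Each order of play in which Left loses at \<open>n\<close> forces a Left win at the
  neighbour in the opposite order.\<close>

lemma outcome_adjacent:
  assumes S: "0 \<notin> S" and mn: "n = Suc m \<or> m = Suc n"
  shows "outcome S n = Out_R \<Longrightarrow> outcome S m = Out_L"
    "outcome S n = Out_P \<Longrightarrow> outcome S m \<in> {Out_L, Out_P}"
    "outcome S n = Out_N \<Longrightarrow> outcome S m \<in> {Out_L, Out_N}"
  using mn Left_wins_adjacent[OF S, of n] Left_wins_adjacent[OF S, of m]
  by (auto simp: outcome_cases_iff[OF S])

lemma outcome_0: "0 \<notin> S \<Longrightarrow> outcome S 0 = Out_L"
  by (simp add: outcome_cases_iff Left_wins_0)

text \<open>At a terminal position parity alone decides, so the same player wins whoever moves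
  first.\<close>

lemma terminal_outcome:
  assumes "0 \<notin> S" "outcome S n \<in> {Out_P, Out_N}"
  shows "\<not> terminal S n"
  using assms by (auto simp: outcome_cases_iff wins_terminal_iff)

section \<open>Runs\<close>

text \<open>Inserting a neighbour keeps the index set convex, so maximality absorbs it.\<close>

lemma maximal_run_adjacent:
  assumes max: "maximal_run f x I" and m: "m \<in> I" "n = Suc m \<or> m = Suc n" and n: "f n = x"
  shows "n \<in> I"
proof -
  from max have I: "\<And>a b c. a \<in> I \<Longrightarrow> b \<in> I \<Longrightarrow> a \<le> c \<Longrightarrow> c \<le> b \<Longrightarrow> c \<in> I"
    "\<And>a. a \<in> I \<Longrightarrow> f a = x"
    unfolding maximal_run_def is_run_def by (meson atLeastAtMost_iff subsetD, blast)
  have "c \<in> insert n I" if ab: "a \<in> insert n I" "b \<in> insert n I" and c: "a \<le> c" "c \<le> b" for a b c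
  proof (cases "c = n")
    case False
    \<comment> \<open>An endpoint equal to \<open>n\<close> can be replaced by \<open>m\<close>: the
      two are adjacent and \<open>c\<close> differs from \<open>n\<close>.\<close>
    have "\<exists>a'\<in>I. a' \<le> c" using False ab(1) c(1) m by (cases "a = n") (auto intro: bexI[of _ m])
    moreover have "\<exists>b'\<in>I. c \<le> b'" using False ab(2) c(2) m by (cases "b = n") (auto intro: bexI[of _ m])
    ultimately show ?thesis using I(1) by blast
  qed simp
  then have "\<forall>a\<in>insert n I. \<forall>b\<in>insert n I. {a..b} \<subseteq> insert n I"
    by (meson atLeastAtMost_iff subsetI)
  then have "is_run f x (insert n I)"
    using I(2) n by (auto simp: is_run_def)
  then show ?thesis using max by (auto simp: maximal_run_def)
qed

lemma maximal_run_before: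
  fixes I :: "nat set"
  assumes "maximal_run f x I" "Inf I \<ge> 1"
  shows "f (Inf I - 1) \<noteq> x"
proof
  assume "f (Inf I - 1) = x"
  moreover have "Inf I \<in> I" using assms(1) by (auto simp: maximal_run_def is_run_def intro: Inf_nat_def1)
  ultimately have "Inf I - 1 \<in> I" using maximal_run_adjacent[OF assms(1)] assms(2) by simp
  then show False using cInf_lower[of "Inf I - 1" I] assms(2) by simp
qed

lemma maximal_run_after:
  assumes "maximal_run f x I" "finite I"
  shows "f (Max I + 1) \<noteq> x"
proof
  assume "f (Max I + 1) = x"
  moreover have "Max I \<in> I" using assms by (auto simp: maximal_run_def is_run_def)
  ultimately have "Max I + 1 \<in> I" using maximal_run_adjacent[OF assms(1)] by simp
  then show False using Max_ge[OF assms(2)] by fastforce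
qed

text \<open>The window of \<open>k\<close> indices starting at \<open>Inf I\<close> is not contained
  in the run, so the run stays strictly below the last index of that window; this also yields
  finiteness.\<close>

lemma run_card_less:
  assumes run: "is_run f x I" and k: "k \<ge> 1"
    and no: "\<And>n. \<not> (\<forall>i\<in>{n..n + k - 1}. f i = x)"
  shows "finite I \<and> card I \<le> k - 1"
proof -
  let ?a = "Inf I"
  have a: "?a \<in> I" using run by (auto simp: is_run_def intro: Inf_nat_def1)
  have "I \<subseteq> {?a..<?a + (k - 1)}"
  proof
    fix b assume b: "b \<in> I"
    then have "{?a..b} \<subseteq> I" using run a by (simp add: is_run_def)
    then have "\<forall>i\<in>{?a..b}. f i = x" using run by (auto simp: is_run_def)
    then have "\<not> {?a..?a + k - 1} \<subseteq> {?a..b}" using no[of ?a] by blast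
    then show "b \<in> {?a..<?a + (k - 1)}" using cInf_lower[OF b] k by auto
  qed
  then show ?thesis
    using finite_subset card_mono[of "{?a..<?a + (k - 1)}" I] by auto
qed

section \<open>Length bounds and flanks of runs\<close>

lemma no_long_P_run:
  assumes S: "S \<subseteq> {2..}" and ne: "S \<noteq> {}"
  shows "\<not> (\<forall>i\<in>{n..n + Inf S - 1}. outcome S i = Out_P)"
proof
  assume all: "\<forall>i\<in>{n..n + Inf S - 1}. outcome S i = Out_P"
  have S0: "0 \<notin> S" using S by auto
  have m: "Inf S \<in> S" using ne by (rule Inf_nat_def1)
  then have m2: "Inf S \<ge> 2" using S by auto
  let ?k = "n + Inf S - 1"
  have P: "outcome S n = Out_P" "outcome S ?k = Out_P" using all m2 by auto
  have n: "n \<ge> 1" using P(1) outcome_0[OF S0] by (cases n) auto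
  have nt: "\<not> terminal S ?k" using terminal_outcome[OF S0] P(2) by simp
  \<comment> \<open>Left loses moving first at \<open>?k\<close>, hence also at the option
    \<open>n - 1\<close> with Right to move.\<close>
  have "?k - Inf S = n - 1" "Inf S \<le> ?k" using n by auto
  then have "\<not> wins S Left Right (n - 1)"
    using P(2) m Left_first_wins_iff[OF S0 nt] unfolding outcome_cases_iff[OF S0] by metis
  moreover have "outcome S (n - 1) \<in> {Out_L, Out_P}"
    using outcome_adjacent(2)[OF S0 _ P(1)] n by simp
  ultimately show False by (auto simp: outcome_cases_iff[OF S0])
qed

lemma no_long_N_run:
  assumes S: "S \<subseteq> {2..}" and ne: "S \<noteq> {}" and fin: "finite S"
  shows "\<not> (\<forall>i\<in>{n..n + Max S - 1}. outcome S i = Out_N)"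
proof
  assume all: "\<forall>i\<in>{n..n + Max S - 1}. outcome S i = Out_N"
  have S0: "0 \<notin> S" using S by auto
  have m2: "Max S \<ge> 2" using Max_in[OF fin ne] S by auto
  let ?k = "n + Max S - 1"
  have N: "outcome S n = Out_N" "outcome S ?k = Out_N" using all m2 by auto
  have n: "n \<ge> 1" using N(1) outcome_0[OF S0] by (cases n) auto
  have nt: "\<not> terminal S ?k" using terminal_outcome[OF S0] N(2) by simp
  \<comment> \<open>A winning first move of Right from the last position of the window.\<close>
  obtain s where s: "s \<in> S" "s \<le> ?k" "\<not> wins S Left Left (?k - s)"
    using N(2) Right_first_wins_iff[OF S0 nt] unfolding outcome_cases_iff[OF S0] by blast
  have "2 \<le> s" "s \<le> Max S" using s S fin by auto
  \<comment> \<open>As \<open>s \<le> Max S\<close>, the target is in the window or just before it;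
    in both cases Left wins there moving first.\<close>
  then consider "?k - s = n - 1" | "?k - s \<in> {n..?k}" using n by force
  then have "outcome S (?k - s) \<in> {Out_L, Out_N}"
  proof cases
    case 1
    then show ?thesis using outcome_adjacent(3)[OF S0 _ N(1)] n by simp
  next
    case 2
    then show ?thesis using all by blast
  qed
  then show False using s(3) by (auto simp: outcome_cases_iff[OF S0])
qed

text \<open>A neighbour can only have outcome \<open>X\<close> or \<open>Out_L\<close>, and
  maximality excludes \<open>X\<close>. The run cannot start at 0, where the outcome is
  \<open>Out_L\<close>.\<close>

lemma maximal_run_flanked:
  assumes S: "0 \<notin> S" and X: "X \<in> {Out_P, Out_N}" and max: "maximal_run (outcome S) X I"
  shows "Inf I \<ge> 1 \<and> outcome S (Inf I - 1) = Out_L \<and> (finite I \<longrightarrow> outcome S (Max I + 1) = Out_L)"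
proof -
  from max have I: "I \<noteq> {}" "\<And>i. i \<in> I \<Longrightarrow> outcome S i = X"
    by (auto simp: maximal_run_def is_run_def)
  have adj: "outcome S m \<in> {Out_L, X}" if "i \<in> I" "i = Suc m \<or> m = Suc i" for i m
    using outcome_adjacent(2,3)[OF S that(2)] I(2)[OF that(1)] X by auto
  have a: "Inf I \<in> I" using I(1) by (rule Inf_nat_def1)
  then have a1: "Inf I \<ge> 1" using I(2)[OF a] outcome_0[OF S] X by (cases "Inf I") auto
  have "outcome S (Inf I - 1) = Out_L"
    using adj[OF a, of "Inf I - 1"] a1 maximal_run_before[OF max] by auto
  moreover have "outcome S (Max I + 1) = Out_L" if "finite I"
    using adj[OF Max_in[OF that I(1)], of "Max I + 1"] maximal_run_after[OF max that] by auto
  ultimately show ?thesis using a1 by blast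
qed

theorem theorem5:
  fixes S :: "nat set"
  assumes "S \<noteq> {}" and "S \<subseteq> {2..}"
  shows
    "(\<forall>n. outcome S n = Out_R \<longrightarrow>
        (n \<ge> 1 \<longrightarrow> outcome S (n - 1) = Out_L) \<and> outcome S (n + 1) = Out_L)
     \<and> (\<forall>n. outcome S n = Out_P \<longrightarrow>
        (n \<ge> 1 \<longrightarrow> outcome S (n - 1) \<in> {Out_L, Out_P}) \<and> outcome S (n + 1) \<in> {Out_L, Out_P})
     \<and> (\<forall>n. outcome S n = Out_N \<longrightarrow>
        (n \<ge> 1 \<longrightarrow> outcome S (n - 1) \<in> {Out_L, Out_N}) \<and> outcome S (n + 1) \<in> {Out_L, Out_N})
     \<and> (\<forall>I. maximal_run (outcome S) Out_P I \<longrightarrow>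
        finite I \<and> card I \<le> Inf S - 1
        \<and> Inf I \<ge> 1 \<and> outcome S (Inf I - 1) = Out_L \<and> outcome S (Max I + 1) = Out_L)
     \<and> (\<forall>I. maximal_run (outcome S) Out_N I \<longrightarrow>
        Inf I \<ge> 1 \<and> outcome S (Inf I - 1) = Out_L
        \<and> (finite I \<longrightarrow> outcome S (Max I + 1) = Out_L))
     \<and> (finite S \<longrightarrow> (\<forall>I. maximal_run (outcome S) Out_N I \<longrightarrow>
        finite I \<and> card I \<le> Max S - 1
        \<and> Inf I \<ge> 1 \<and> outcome S (Inf I - 1) = Out_L \<and> outcome S (Max I + 1) = Out_L))"
proof -
  have S0: "0 \<notin> S" using assms(2) by auto
  have "Inf S \<ge> 1" using Inf_nat_def1[OF assms(1)] assms(2) by auto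
  then have P: "finite I \<and> card I \<le> Inf S - 1" if "maximal_run (outcome S) Out_P I" for I
    using run_card_less[OF _ _ no_long_P_run[OF assms(2,1)]] that by (simp add: maximal_run_def)
  have N: "finite I \<and> card I \<le> Max S - 1"
    if "finite S" "maximal_run (outcome S) Out_N I" for I
  proof -
    have "Max S \<ge> 1" using Max_in[OF that(1) assms(1)] assms(2) by auto
    then show ?thesis
      using run_card_less[OF _ _ no_long_N_run[OF assms(2,1) that(1)]] that(2)
      by (simp add: maximal_run_def)
  qed
  note adj = outcome_adjacent[OF S0]
  show ?thesis
  proof (intro conjI)
    show "\<forall>n. outcome S n = Out_R \<longrightarrow>
        (n \<ge> 1 \<longrightarrow> outcome S (n - 1) = Out_L) \<and> outcome S (n + 1) = Out_L"
      by (intro allI impI conjI adj(1)) auto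
    show "\<forall>n. outcome S n = Out_P \<longrightarrow>
        (n \<ge> 1 \<longrightarrow> outcome S (n - 1) \<in> {Out_L, Out_P}) \<and> outcome S (n + 1) \<in> {Out_L, Out_P}"
      by (intro allI impI conjI adj(2)) auto
    show "\<forall>n. outcome S n = Out_N \<longrightarrow>
        (n \<ge> 1 \<longrightarrow> outcome S (n - 1) \<in> {Out_L, Out_N}) \<and> outcome S (n + 1) \<in> {Out_L, Out_N}"
      by (intro allI impI conjI adj(3)) auto
  qed (use P N maximal_run_flanked[OF S0] in blast)+
qed

end
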